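(* Let $\mathcal{H}_1,\mathcal{H}_2,\mathcal{H}_3$ be real or complex Hilbert spaces (over the same field), let $R$ be a densely defined linear operator from $\mathcal{H}_2$ to $\mathcal{H}_3$ and $S$ a densely defined linear operator from $\mathcal{H}_1$ to $\mathcal{H}_2$. The following assertions are equivalent: (i) $RS$ is densely defined and $(RS)^*=S^*R^*$. (ii) $G(RS)^{\perp}=W\langle G(S^*R^* )\rangle$. (iii) $G(RS)^{\perp}\subseteq\operatorname{ran}(M_{RS,\,S^*R^*})$.
   Context: Linear operators are defined on linear subspaces (not necessarily closed or bounded); products have their natural domains, $\operatorname{dom}(RS)=\{h\in\operatorname{dom}S: Sh\in\operatorname{dom}R\}$, and equality of operators includes equality of domains. $G(A)=\{(h,Ah): h\in\operatorname{dom}A\}$ is the graph, and $\perp$ is taken in the product Hilbert space $\mathcal{H}_1\times\mathcal{H}_3$. $W:\mathcal{H}_3\times\mathcal{H}_1\to\mathcal{H}_1\times\mathcal{H}_3$ is the flip $W(k,h)=(-h,k)$, and $W\langle\cdot\rangle$ denotes image. For operators $A$ from $\mathcal{H}_1$ to $\mathcal{H}_3$ and $B$ from $\mathcal{H}_3$ to $\mathcal{H}_1$, $M_{A,B}$ is the operator in $\mathcal{H}_1\times\mathcal{H}_3$ with domain $\operatorname{dom}A\times\operatorname{dom}B$ given by $M_{A,B}(h,k)=(h-Bk,\,Ah+k)$. *)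

theory Defs
  imports "HOL-Analysis.Analysis"
begin

section \<open>Scalars\<close>

text \<open>
  The class of scalar fields \<open>\<real>\<close> and \<open>\<complex>\<close>, treated uniformly.  By the last axiom such a field
  has dimension at most two over the reals, so it is isomorphic to one of the two instances below;
  the other axioms then force \<open>kcnj\<close> to be the identity or the complex conjugation.
\<close>

class real_or_complex = real_normed_field +
  fixes kcnj :: "'a \<Rightarrow> 'a"
  assumes mult_kcnj: "z * kcnj z = (norm z)\<^sup>2 *\<^sub>R 1"
    and kcnj_add: "kcnj (z + w) = kcnj z + kcnj w"
    and kcnj_mult: "kcnj (z * w) = kcnj z * kcnj w"
    and ex_generator: "\<exists>j. \<forall>z. \<exists>a b. z = a *\<^sub>R 1 + b *\<^sub>R j"

instantiation real :: real_or_complex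
begin
definition kcnj_real :: "real \<Rightarrow> real" where "kcnj_real x = x"
instance by standard (auto simp: kcnj_real_def power2_eq_square intro: exI[of _ 0])
end

instantiation complex :: real_or_complex
begin
definition kcnj_complex :: "complex \<Rightarrow> complex" where "kcnj_complex = cnj"
instance
proof
  show "\<exists>j::complex. \<forall>z. \<exists>a b. z = a *\<^sub>R 1 + b *\<^sub>R j"
    by (rule exI[of _ \<i>]) (simp add: complex_eq_iff)
qed (auto simp: kcnj_complex_def complex_norm_square[symmetric] scaleR_conv_of_real)
end

section \<open>Hilbert spaces\<close>

text \<open>
  The type supplies the complete norm topology.  The inner product \<open>ip\<close> over the scalar field
  \<open>'k\<close> is linear in its first argument and induces the norm of the type; by polarization the real
  inner product of the type is the real part of \<open>ip\<close>.
\<close>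

locale hilbert_space = vector_space scale
  for scale :: "'k::real_or_complex \<Rightarrow> 'a::{real_inner,complete_space} \<Rightarrow> 'a" +
  fixes ip :: "'a \<Rightarrow> 'a \<Rightarrow> 'k"
  assumes scale_of_real: "scale (of_real r) x = r *\<^sub>R x"
    and ip_add_left: "ip (x + y) z = ip x z + ip y z"
    and ip_scale_left: "ip (scale c x) y = c * ip x y"
    and ip_kcnj: "ip y x = kcnj (ip x y)"
    and ip_self: "ip x x = of_real ((norm x)\<^sup>2)"

definition prod_scale :: "('k \<Rightarrow> 'a \<Rightarrow> 'a) \<Rightarrow> ('k \<Rightarrow> 'b \<Rightarrow> 'b) \<Rightarrow> 'k \<Rightarrow> 'a \<times> 'b \<Rightarrow> 'a \<times> 'b" where
  "prod_scale s1 s2 c = (\<lambda>(x, y). (s1 c x, s2 c y))"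

definition prod_ip ::
  "('a \<Rightarrow> 'a \<Rightarrow> 'k) \<Rightarrow> ('b \<Rightarrow> 'b \<Rightarrow> 'k) \<Rightarrow> 'a \<times> 'b \<Rightarrow> 'a \<times> 'b \<Rightarrow> 'k::plus" where
  "prod_ip ip1 ip2 = (\<lambda>(x, y) (u, v). ip1 x u + ip2 y v)"

definition orthogonal_complement :: "('a \<Rightarrow> 'a \<Rightarrow> 'k::zero) \<Rightarrow> 'a set \<Rightarrow> 'a set" where
  "orthogonal_complement ip A = {y. \<forall>x\<in>A. ip x y = 0}"

lemma hilbert_space_real:
  "hilbert_space (scaleR :: real \<Rightarrow> 'a \<Rightarrow> 'a::{real_inner,complete_space}) inner"
  by unfold_locales
    (auto simp: kcnj_real_def inner_commute power2_norm_eq_inner algebra_simps)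

lemma hilbert_space_complex: "hilbert_space ((*) :: complex \<Rightarrow> _) (\<lambda>x y. x * cnj y)"
  by unfold_locales
    (auto simp: kcnj_complex_def scaleR_conv_of_real complex_norm_square[symmetric] algebra_simps)

lemma hilbert_space_prod:
  assumes "hilbert_space s1 ip1" "hilbert_space s2 ip2"
  shows "hilbert_space (prod_scale s1 s2) (prod_ip ip1 ip2)"
proof -
  interpret H1: hilbert_space s1 ip1 by fact
  interpret H2: hilbert_space s2 ip2 by fact
  have norm_sq: "(of_real (norm (x, y)))\<^sup>2 = (of_real (norm x))\<^sup>2 + ((of_real (norm y))\<^sup>2 :: 'a)"
    for x :: 'b and y :: 'c
    by (simp add: norm_Pair flip: of_real_power of_real_add)
  show ?thesis
    by unfold_locales
      (auto simp: prod_scale_def prod_ip_def norm_sq H1.scale_of_real H2.scale_of_real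
        H1.ip_add_left H2.ip_add_left H1.ip_scale_left H2.ip_scale_left
        H1.ip_self H2.ip_self kcnj_add H1.ip_kcnj[symmetric] H2.ip_kcnj[symmetric]
        algebra_simps split: prod.splits)
qed

section \<open>Operators\<close>

text \<open>
  An operator defined on a subspace is a partial function \<open>T\<close> with domain \<open>dom T\<close> and graph
  \<open>Map.graph T\<close>; equality of partial functions includes equality of domains, and \<open>R \<circ>\<^sub>m S\<close> has
  the natural domain of the product.
\<close>

definition linear_operator ::
  "('k::field \<Rightarrow> 'a \<Rightarrow> 'a) \<Rightarrow> ('k \<Rightarrow> 'b \<Rightarrow> 'b) \<Rightarrow> ('a::ab_group_add \<rightharpoonup> 'b::ab_group_add) \<Rightarrow> bool" where
  "linear_operator s1 s2 T \<longleftrightarrow>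
     module.subspace s1 (dom T) \<and>
     (\<forall>x\<in>dom T. \<forall>y\<in>dom T. the (T (x + y)) = the (T x) + the (T y)) \<and>
     (\<forall>c. \<forall>x\<in>dom T. the (T (s1 c x)) = s2 c (the (T x)))"

definition densely_defined :: "('a::topological_space \<rightharpoonup> 'b) \<Rightarrow> bool" where
  "densely_defined T \<longleftrightarrow> closure (dom T) = UNIV"

text \<open>
  The adjoint is meaningful only for densely defined \<open>T\<close>, for which the \<open>h\<close> below is unique.
\<close>

definition op_adjoint ::
  "('a \<Rightarrow> 'a \<Rightarrow> 'k) \<Rightarrow> ('b \<Rightarrow> 'b \<Rightarrow> 'k) \<Rightarrow> ('a \<rightharpoonup> 'b) \<Rightarrow> ('b \<rightharpoonup> 'a)" where
  "op_adjoint ip1 ip2 T = (\<lambda>k.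
     if \<exists>h. \<forall>x\<in>dom T. ip2 (the (T x)) k = ip1 x h
     then Some (THE h. \<forall>x\<in>dom T. ip2 (the (T x)) k = ip1 x h)
     else None)"

definition flip :: "'b \<times> 'a \<Rightarrow> 'a::uminus \<times> 'b" where
  "flip = (\<lambda>(k, h). (- h, k))"

definition block_operator ::
  "('a::minus \<rightharpoonup> 'b::plus) \<Rightarrow> ('b \<rightharpoonup> 'a) \<Rightarrow> ('a \<times> 'b \<rightharpoonup> 'a \<times> 'b)" where
  "block_operator A B = (\<lambda>(h, k).
     if h \<in> dom A \<and> k \<in> dom B then Some (h - the (B k), the (A h) + k) else None)"

lemma op_adjoint_eq_Some_iff:
  fixes s1 :: "'k::real_or_complex \<Rightarrow> 'a::{real_inner,complete_space} \<Rightarrow> 'a"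
  assumes "hilbert_space s1 ip1" and "densely_defined T"
  shows "op_adjoint ip1 ip2 T k = Some h \<longleftrightarrow> (\<forall>x\<in>dom T. ip2 (the (T x)) k = ip1 x h)"
proof -
  interpret hilbert_space s1 ip1 by fact
  have ip_diff: "ip1 x (a - b) = ip1 x a - ip1 x b" for x a b
  proof -
    have "ip1 (a - b + b) x = ip1 (a - b) x + ip1 b x" by (rule ip_add_left)
    then have "kcnj (ip1 a x) = kcnj (ip1 (a - b) x) + kcnj (ip1 b x)"
      by (simp add: kcnj_add)
    then show ?thesis by (simp add: ip_kcnj[symmetric])
  qed
  have uniq: "a = b"
    if a: "\<forall>x\<in>dom T. ip2 (the (T x)) k = ip1 x a" and b: "\<forall>x\<in>dom T. ip2 (the (T x)) k = ip1 x b"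
    for a b
  proof -
    define d where "d = a - b"
    have orth: "ip1 x d = 0" if "x \<in> dom T" for x
      using a b that by (simp add: d_def ip_diff)
    have pyth: "norm d \<le> norm (d - x)" if "x \<in> dom T" for x
    proof -
      have xd: "ip1 x d = 0" and dx: "ip1 d x = 0"
        using orth[OF that] ip_kcnj[of d x] kcnj_add[of 0 0] by simp_all
      have "ip1 (d - x + x) (d - x) = ip1 (d - x) (d - x) + ip1 x (d - x)" by (rule ip_add_left)
      then have "ip1 (d - x) (d - x) = ip1 d d + ip1 x x"
        by (simp add: ip_diff xd dx)
      then have "(of_real ((norm (d - x))\<^sup>2) :: 'k) = of_real ((norm d)\<^sup>2 + (norm x)\<^sup>2)"
        by (simp add: ip_self)
      then have "(norm (d - x))\<^sup>2 = (norm d)\<^sup>2 + (norm x)\<^sup>2" by (simp only: of_real_eq_iff)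
      then show ?thesis by (intro power2_le_imp_le[OF _ norm_ge_zero]) simp
    qed
    have "d \<in> closure (dom T)" using assms(2) by (simp add: densely_defined_def)
    then have "\<exists>x\<in>dom T. dist x d < e" if "e > 0" for e
      using that by (simp add: closure_approachable)
    then have "norm d < e" if "e > 0" for e
      using pyth that by (metis dist_norm norm_minus_commute order_le_less_trans)
    then have "norm d = 0" by (metis less_irrefl norm_ge_zero order_le_less)
    then show ?thesis by (simp add: d_def)
  qed
  define P where "P h \<longleftrightarrow> (\<forall>x\<in>dom T. ip2 (the (T x)) k = ip1 x h)" for h
  have "a = b" if "P a" "P b" for a b
    using that unfolding P_def by (rule uniq)
  then have the_P: "(THE h. P h) = a" if "P a" for a
    using that by (intro the_equality)
  have "op_adjoint ip1 ip2 T k = (if \<exists>h. P h then Some (THE h. P h) else None)"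
    unfolding op_adjoint_def P_def ..
  then show ?thesis
    unfolding P_def[symmetric] using the_P by (auto split: if_splits)
qed

end

theory Submission
  imports Defs
begin

text \<open>
  Write \<open>A = RS\<close> and \<open>B = S\<^sup>*R\<^sup>*\<close>.  Always \<open>\<langle>Ah, k\<rangle> = \<langle>h, Bk\<rangle>\<close>, that is, the flipped graph of \<open>B\<close> lies in
  the orthogonal complement of the graph of \<open>A\<close>.  If every vector of that complement has the form
  \<open>(h - Bk, Ah + k)\<close>, then subtracting \<open>(- Bk, k)\<close> shows that \<open>(h, Ah)\<close> is orthogonal to the graph of
  \<open>A\<close> and hence zero, so the complement is the flipped graph of \<open>B\<close>.  In that case
  \<open>u \<bottom> dom A\<close> means that \<open>(u, 0)\<close> is in the flipped graph, so \<open>u = - B0 = 0\<close> and \<open>A\<close> is densely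
  defined by the projection theorem.
\<close>

section \<open>Nearest points and density for the real inner product\<close>

lemma ex_nearest_point_closed_convex:
  fixes C :: "'a::{real_inner,complete_space} set"
  assumes "closed C" "convex C" "C \<noteq> {}"
  obtains p where "p \<in> C" "\<And>x. x \<in> C \<Longrightarrow> norm (u - p) \<le> norm (u - x)"
proof -
  define d where "d = infdist u C"
  have d_le: "d \<le> norm (u - x)" if "x \<in> C" for x
    using infdist_le[OF that, of u] by (simp add: d_def dist_norm)
  have d_ge: "0 \<le> d" by (simp add: d_def infdist_nonneg)
  have "\<exists>x\<in>C. norm (u - x) < d + e" if "e > 0" for e
  proof (rule ccontr)
    assume "\<not> ?thesis"
    then have "d + e \<le> infdist u C"
      using assms(3) by (auto simp: infdist_def dist_norm not_less intro!: cINF_greatest)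
    with that show False by (simp add: d_def)
  qed
  then have "\<exists>x\<in>C. norm (u - x) < d + 1 / real (Suc n)" for n by simp
  then obtain X where XC: "X n \<in> C" and Xd: "norm (u - X n) < d + 1 / real (Suc n)" for n
    by metis
  \<comment> \<open>Parallelogram law: the midpoint of \<open>X m\<close> and \<open>X n\<close>
    lies in \<open>C\<close>, so its distance from \<open>u\<close> is at least \<open>d\<close>. As
    both points are themselves almost at distance \<open>d\<close> from \<open>u\<close>, they must
    be close together.\<close>
  have X_dist: "(dist (X m) (X n))\<^sup>2 \<le> 4 * ((2 * d + 1) / real (Suc N))"
    if "N \<le> m" "N \<le> n" for m n N
  proof -
    define e where "e = 1 / real (Suc N)"
    have e: "0 < e" "e \<le> 1" by (auto simp: e_def)
    have X_sq: "(norm (u - X k))\<^sup>2 \<le> d\<^sup>2 + (2 * d + 1) * e" if "N \<le> k" for k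
    proof -
      have "1 / real (Suc k) \<le> e" unfolding e_def using that by (intro divide_left_mono) auto
      then have "norm (u - X k) \<le> d + e" using Xd[of k] by linarith
      then have "(norm (u - X k))\<^sup>2 \<le> (d + e)\<^sup>2" by (intro power_mono) auto
      also have "\<dots> = d\<^sup>2 + 2 * d * e + e * e" by (simp add: power2_eq_square algebra_simps)
      \<comment> \<open>Absorbing the quadratic term into the linear one produces the constant
        \<open>2 * d + 1\<close>.\<close>
      also have "e * e \<le> 1 * e" using e by (intro mult_right_mono) auto
      finally show ?thesis by (simp add: algebra_simps)
    qed
    have "(1/2) *\<^sub>R X m + (1/2) *\<^sub>R X n \<in> C"
      using convexD[OF assms(2) XC XC, of "1/2" "1/2"] by simp
    then have "d\<^sup>2 \<le> (norm (u - ((1/2) *\<^sub>R X m + (1/2) *\<^sub>R X n)))\<^sup>2"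
      by (intro power_mono d_le d_ge)
    moreover have "(dist (X m) (X n))\<^sup>2 = 2 * (norm (u - X m))\<^sup>2 + 2 * (norm (u - X n))\<^sup>2
        - 4 * (norm (u - ((1/2) *\<^sub>R X m + (1/2) *\<^sub>R X n)))\<^sup>2"
      unfolding dist_norm power2_norm_eq_inner
      by (simp add: inner_diff_left inner_diff_right inner_add_left inner_add_right
          inner_commute algebra_simps)
    ultimately have "(dist (X m) (X n))\<^sup>2 \<le> 4 * ((2 * d + 1) * e)"
      using X_sq[OF that(1)] X_sq[OF that(2)] by linarith
    then show ?thesis by (simp add: e_def)
  qed
  have "Cauchy X"
  proof (rule metric_CauchyI)
    fix e :: real
    assume "0 < e"
    then obtain N where N: "inverse (real (Suc N)) < e\<^sup>2 / (4 * (2 * d + 1))"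
      using d_ge reals_Archimedean[of "e\<^sup>2 / (4 * (2 * d + 1))"] by auto
    then have "4 * ((2 * d + 1) / real (Suc N)) < e\<^sup>2"
      using d_ge by (simp add: field_simps del: of_nat_Suc)
    then have "dist (X m) (X n) < e" if "N \<le> m" "N \<le> n" for m n
      using X_dist[OF that] \<open>0 < e\<close> by (intro power2_less_imp_less[of _ e]) auto
    then show "\<exists>M. \<forall>m\<ge>M. \<forall>n\<ge>M. dist (X m) (X n) < e" by blast
  qed
  then obtain p where p: "X \<longlonglongrightarrow> p" using Cauchy_convergent convergentD by blast
  have "p \<in> C" using closed_sequentially[OF assms(1) _ p] XC by blast
  moreover have "norm (u - p) \<le> d"
  proof (rule LIMSEQ_le)
    show "(\<lambda>n. norm (u - X n)) \<longlonglongrightarrow> norm (u - p)" by (intro tendsto_intros p)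
    show "(\<lambda>n. d + 1 / real (Suc n)) \<longlonglongrightarrow> d"
      using tendsto_add[OF tendsto_const LIMSEQ_inverse_real_of_nat, of d] by (simp add: inverse_eq_divide)
    show "\<exists>N. \<forall>n\<ge>N. norm (u - X n) \<le> d + 1 / real (Suc n)" using Xd less_imp_le by blast
  qed
  ultimately show thesis using d_le that order_trans by blast
qed

text \<open>Projection argument: if \<open>p\<close> is the point of \<open>closure D\<close>
  nearest to \<open>u\<close>, then \<open>u - p\<close> is orthogonal to \<open>D\<close>, hence
  zero, and \<open>u\<close> lies in the closure.\<close>

lemma subspace_dense_if_orthogonal_trivial:
  fixes D :: "'a::{real_inner,complete_space} set"
  assumes "subspace D" and triv: "\<And>z. (\<And>x. x \<in> D \<Longrightarrow> x \<bullet> z = 0) \<Longrightarrow> z = 0"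
  shows "closure D = UNIV"
proof -
  have "u \<in> closure D" for u
  proof -
    have "convex (closure D)" "closure D \<noteq> {}"
      using assms(1) subspace_imp_convex convex_closure subspace_0 by auto
    then obtain p where p: "p \<in> closure D" "\<And>x. x \<in> closure D \<Longrightarrow> norm (u - p) \<le> norm (u - x)"
      using ex_nearest_point_closed_convex[of "closure D" u] by auto
    have "x \<bullet> (u - p) = 0" if "x \<in> D" for x
    proof -
      \<comment> \<open>For nonzero \<open>x\<close> this \<open>t\<close> minimizes the norm of
        \<open>u - p - t *\<^sub>R x\<close>. Since moving \<open>p\<close> by a multiple of
        \<open>x\<close> stays in \<open>closure D\<close>, minimality of \<open>p\<close> leaves no
        possible gain, which forces the inner product to vanish.\<close>
      define t where "t = (x \<bullet> (u - p)) / (x \<bullet> x)"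
      have "(\<lambda>y. t *\<^sub>R x + y) ` D \<subseteq> D"
        using assms(1) that by (auto intro: subspace_add subspace_mul)
      then have "(\<lambda>y. t *\<^sub>R x + y) ` closure D \<subseteq> closure D"
        by (metis closure_translation closure_mono)
      then have "norm (u - p) \<le> norm (u - (t *\<^sub>R x + p))" using p by blast
      then have "(u - p) \<bullet> (u - p) \<le> (u - p - t *\<^sub>R x) \<bullet> (u - p - t *\<^sub>R x)"
        by (simp add: norm_le algebra_simps)
      then have "0 \<le> t * t * (x \<bullet> x) - 2 * t * (x \<bullet> (u - p))"
        by (simp add: inner_diff_left inner_diff_right inner_commute algebra_simps)
      then have "(x \<bullet> (u - p)) * (x \<bullet> (u - p)) \<le> 0" if "x \<noteq> 0"
        using that by (simp add: t_def field_simps)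
      then show ?thesis by (cases "x = 0") (auto simp: mult_le_0_iff)
    qed
    then have "u - p = 0" by (rule triv)
    then show ?thesis using p(1) by simp
  qed
  then show ?thesis by auto
qed

section \<open>From the real inner product to the one over the scalar field\<close>

lemma kcnj_0 [simp]: "kcnj 0 = (0::'k::real_or_complex)"
  using kcnj_add[of "0::'k" 0] by simp

lemma kcnj_of_real: "kcnj (of_real r) = (of_real r :: 'k::real_or_complex)"
proof (cases "r = 0")
  case False
  have "of_real r * kcnj (of_real r) = (of_real r * of_real r :: 'k)"
    using mult_kcnj[of "of_real r :: 'k"] by (simp add: scaleR_conv_of_real power2_eq_square)
  with False show ?thesis by simp
qed simp

context hilbert_space
begin

lemma ip_add_right: "ip x (y + z) = ip x y + ip x z"
  by (metis ip_add_left ip_kcnj kcnj_add)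

lemma ip_zero_right [simp]: "ip x 0 = 0"
  using ip_add_right[of x 0 0] by simp

lemma ip_minus_right: "ip x (- y) = - ip x y"
  using ip_add_right[of x y "- y"] by (simp add: add_eq_0_iff)

text \<open>Expand the squared norm of \<open>x + y\<close> once with \<open>ip\<close> and once
  with the real inner product; a real value \<open>r\<close> equals its conjugate, so the cross
  terms are \<open>2 * r\<close> in both.\<close>

lemma inner_eq_if_ip_real:
  assumes "ip x y = of_real r"
  shows "x \<bullet> y = r"
proof -
  have "ip (x + y) (x + y) = ip x x + ip y y + (ip x y + kcnj (ip x y))"
    by (simp add: ip_add_left ip_add_right ip_kcnj[of y x])
  then have "of_real ((norm (x + y))\<^sup>2) = (of_real ((norm x)\<^sup>2 + (norm y)\<^sup>2 + 2 * r) :: 'k)"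
    by (simp add: ip_self assms kcnj_of_real)
  then have "(norm (x + y))\<^sup>2 = (norm x)\<^sup>2 + (norm y)\<^sup>2 + 2 * r"
    by (simp only: of_real_eq_iff)
  then show ?thesis by (simp add: power2_norm_eq_inner inner_add_left inner_add_right inner_commute)
qed

text \<open>Here \<open>subspace\<close> refers to the scalar field. Rescaling \<open>x\<close> by
  the conjugate of \<open>ip x z\<close> stays in \<open>D\<close> and makes the product with
  \<open>z\<close> real, namely the squared norm of \<open>ip x z\<close>; real orthogonality makes
  it zero.\<close>

lemma ip_eq_0_on_subspace:
  assumes "subspace D" "x \<in> D" "\<And>y. y \<in> D \<Longrightarrow> y \<bullet> z = 0"
  shows "ip x z = 0"
proof -
  define c where "c = ip x z"
  have "ip (scale (kcnj c) x) z = of_real ((norm c)\<^sup>2)"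
    using mult_kcnj[of c] by (simp add: ip_scale_left c_def mult.commute scaleR_conv_of_real)
  then have "scale (kcnj c) x \<bullet> z = (norm c)\<^sup>2" by (rule inner_eq_if_ip_real)
  then show ?thesis using assms subspace_scale[OF assms(1,2), of "kcnj c"] by (simp add: c_def)
qed

lemma dense_if_orthogonal_complement_trivial:
  assumes D: "subspace D" and triv: "orthogonal_complement ip D \<subseteq> {0}"
  shows "closure D = UNIV"
proof (rule subspace_dense_if_orthogonal_trivial)
  show "real_vector.subspace D"
    using subspace_0[OF D] subspace_add[OF D] subspace_scale[OF D]
    by (auto simp: real_vector.subspace_def simp flip: scale_of_real)
  show "z = 0" if "\<And>x. x \<in> D \<Longrightarrow> x \<bullet> z = 0" for z
    using triv ip_eq_0_on_subspace[OF D _ that] by (auto simp: orthogonal_complement_def)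
qed

end

section \<open>Products of operators, graphs and adjoint relations\<close>

lemma linear_operator_zero:
  assumes "hilbert_space s1 ip1" "linear_operator s1 s2 T"
  shows "T 0 = Some 0"
proof -
  interpret H1: hilbert_space s1 ip1 by fact
  have 0: "0 \<in> dom T" using assms(2) H1.subspace_0 by (auto simp: linear_operator_def)
  then have "the (T (0 + 0)) = the (T 0) + the (T 0)"
    using assms(2) unfolding linear_operator_def by blast
  with 0 show ?thesis by auto
qed

lemma subspace_dom_map_comp:
  assumes "hilbert_space s1 ip1" "hilbert_space s2 ip2"
    and R: "linear_operator s2 s3 R" and S: "linear_operator s1 s2 S"
  shows "module.subspace s1 (dom (R \<circ>\<^sub>m S))"
proof -
  interpret H1: hilbert_space s1 ip1 by fact
  interpret H2: hilbert_space s2 ip2 by fact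
  have domR: "H2.subspace (dom R)" and domS: "H1.subspace (dom S)"
    using R S by (auto simp: linear_operator_def)
  have dom_iff: "x \<in> dom (R \<circ>\<^sub>m S) \<longleftrightarrow> x \<in> dom S \<and> the (S x) \<in> dom R" for x
    by (force simp: map_comp_Some_iff)
  have S_add: "the (S (x + y)) = the (S x) + the (S y)" if "x \<in> dom S" "y \<in> dom S" for x y
    using S that unfolding linear_operator_def by blast
  have S_scale: "the (S (s1 c x)) = s2 c (the (S x))" if "x \<in> dom S" for x c
    using S that unfolding linear_operator_def by blast
  have "S 0 = Some 0" by (rule linear_operator_zero[OF assms(1) S])
  then have "0 \<in> dom (R \<circ>\<^sub>m S)"
    unfolding dom_iff using H1.subspace_0[OF domS] H2.subspace_0[OF domR] by simp
  moreover have "x + y \<in> dom (R \<circ>\<^sub>m S)" if "x \<in> dom (R \<circ>\<^sub>m S)" "y \<in> dom (R \<circ>\<^sub>m S)" for x y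
    using that unfolding dom_iff by (simp only: S_add H1.subspace_add[OF domS] H2.subspace_add[OF domR])
  moreover have "s1 c x \<in> dom (R \<circ>\<^sub>m S)" if "x \<in> dom (R \<circ>\<^sub>m S)" for x c
    using that unfolding dom_iff by (simp only: S_scale H1.subspace_scale[OF domS] H2.subspace_scale[OF domR])
  ultimately show ?thesis by (auto simp: H1.subspace_def)
qed

text \<open>The sign in \<open>- h\<close> cancels when the two components are summed, so
  orthogonality to the graph becomes the relation that defines the adjoint.\<close>

lemma mem_orthogonal_complement_graph_iff:
  assumes "hilbert_space s1 ip1"
  shows "(- h, k) \<in> orthogonal_complement (prod_ip ip1 ip2) (Map.graph T) \<longleftrightarrow>
    (\<forall>x\<in>dom T. ip2 (the (T x)) k = ip1 x h)"
proof -
  interpret hilbert_space s1 ip1 by fact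
  show ?thesis
    by (force simp: orthogonal_complement_def prod_ip_def Map.graph_def ip_minus_right)
qed

lemma mem_flip_graph_iff: "(- h, k) \<in> flip ` Map.graph T \<longleftrightarrow> T k = Some (h::'a::group_add)"
  by (force simp: flip_def Map.graph_def)

section \<open>The two equivalences\<close>

lemma dense_and_adjoint_eq_iff:
  assumes "hilbert_space s1 ip1" "module.subspace s1 (dom A)" "B 0 = Some 0"
    and H3: "hilbert_space s3 ip3"
  shows "densely_defined A \<and> op_adjoint ip1 ip3 A = B \<longleftrightarrow>
    orthogonal_complement (prod_ip ip1 ip3) (Map.graph A) = flip ` Map.graph B"
proof -
  interpret H1: hilbert_space s1 ip1 by fact
  interpret H3: hilbert_space s3 ip3 by fact
  \<comment> \<open>Every pair can be written as \<open>(- h, k)\<close>, so comparing the two sets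
    amounts to comparing the adjoint relation of \<open>A\<close> with the graph of
    \<open>B\<close>.\<close>
  have graph_eq_iff: "orthogonal_complement (prod_ip ip1 ip3) (Map.graph A) = flip ` Map.graph B
      \<longleftrightarrow> (\<forall>h k. (\<forall>x\<in>dom A. ip3 (the (A x)) k = ip1 x h) \<longleftrightarrow> B k = Some h)"
    unfolding mem_orthogonal_complement_graph_iff[OF assms(1), symmetric] mem_flip_graph_iff[symmetric]
    by (metis (no_types, opaque_lifting) add.inverse_inverse prod.exhaust subsetI subset_antisym)
  have "densely_defined A"
    if "\<And>h k. (\<forall>x\<in>dom A. ip3 (the (A x)) k = ip1 x h) \<longleftrightarrow> B k = Some h"
  proof -
    \<comment> \<open>At \<open>k = 0\<close> the adjoint relation says that \<open>h\<close> is
      orthogonal to \<open>dom A\<close>; it then gives \<open>B 0 = Some h\<close>, so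
      \<open>h = 0\<close>.\<close>
    have "orthogonal_complement ip1 (dom A) \<subseteq> {0}"
      using that[of 0] assms(3) by (auto simp: orthogonal_complement_def)
    then show ?thesis
      unfolding densely_defined_def by (rule H1.dense_if_orthogonal_complement_trivial[OF assms(2)])
  qed
  moreover have "op_adjoint ip1 ip3 A = B
      \<longleftrightarrow> (\<forall>h k. (\<forall>x\<in>dom A. ip3 (the (A x)) k = ip1 x h) \<longleftrightarrow> B k = Some h)"
    if "densely_defined A"
    unfolding op_adjoint_eq_Some_iff[OF assms(1) that, symmetric]
    by (metis ext not_None_eq)
  ultimately show ?thesis unfolding graph_eq_iff by blast
qed

lemma orthogonal_complement_eq_iff_subset_ran:
  assumes "hilbert_space s1 ip1" "hilbert_space s3 ip3" "A 0 = Some 0"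
    and sub: "flip ` Map.graph B \<subseteq> orthogonal_complement (prod_ip ip1 ip3) (Map.graph A)"
  shows "orthogonal_complement (prod_ip ip1 ip3) (Map.graph A) = flip ` Map.graph B \<longleftrightarrow>
    orthogonal_complement (prod_ip ip1 ip3) (Map.graph A) \<subseteq> ran (block_operator A B)"
    (is "?C = ?W \<longleftrightarrow> _")
proof
  interpret P: hilbert_space "prod_scale s1 s3" "prod_ip ip1 ip3"
    by (rule hilbert_space_prod) fact+
  assume ran: "?C \<subseteq> ran (block_operator A B)"
  have "w \<in> ?W" if "w \<in> ?C" for w
  proof -
    have "w \<in> ran (block_operator A B)" using ran that by blast
    then obtain h k where hk: "h \<in> dom A" "k \<in> dom B" "w = (h - the (B k), the (A h) + k)"
      by (auto simp: ran_def block_operator_def split: if_splits)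
    define g where "g = (h, the (A h))"
    define v where "v = (- the (B k), k)"
    have g: "g \<in> Map.graph A" using hk(1) by (auto simp: g_def Map.graph_def)
    have v: "v \<in> ?W" using hk(2) by (auto simp: v_def mem_flip_graph_iff)
    have w: "w = g + v" by (simp add: hk(3) g_def v_def)
    \<comment> \<open>Both \<open>w\<close> and \<open>v\<close> are orthogonal to the graph, which
      contains \<open>g\<close>; so \<open>g = w - v\<close> is orthogonal to itself.\<close>
    have "prod_ip ip1 ip3 g w = 0" "prod_ip ip1 ip3 g v = 0"
      using that v sub g by (auto simp: orthogonal_complement_def)
    then have "prod_ip ip1 ip3 g g = 0" by (simp add: w P.ip_add_right)
    then have "g = 0" by (simp add: P.ip_self)
    with v w show ?thesis by simp
  qed
  with sub show "?C = ?W" by blast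
next
  assume "?C = ?W"
  moreover have "w \<in> ran (block_operator A B)" if w: "w \<in> ?W" for w
  proof -
    obtain h k where "B k = Some h" "w = (- h, k)"
      using w by (auto simp: flip_def Map.graph_def)
    \<comment> \<open>With first argument 0 and \<open>A 0 = Some 0\<close>, the block operator
      returns exactly the flipped graph point of \<open>B\<close> at \<open>k\<close>.\<close>
    then have "block_operator A B (0, k) = Some w" using assms(3) by (auto simp: block_operator_def)
    then show ?thesis by (rule ranI)
  qed
  ultimately show "?C \<subseteq> ran (block_operator A B)" by blast
qed

theorem theorem4p2:
  fixes scale1 :: "'k::real_or_complex \<Rightarrow> 'a::{real_inner,complete_space} \<Rightarrow> 'a"
    and scale2 :: "'k \<Rightarrow> 'b::{real_inner,complete_space} \<Rightarrow> 'b"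
    and scale3 :: "'k \<Rightarrow> 'c::{real_inner,complete_space} \<Rightarrow> 'c"
    and ip1 :: "'a \<Rightarrow> 'a \<Rightarrow> 'k" and ip2 :: "'b \<Rightarrow> 'b \<Rightarrow> 'k" and ip3 :: "'c \<Rightarrow> 'c \<Rightarrow> 'k"
    and R :: "'b \<rightharpoonup> 'c" and S :: "'a \<rightharpoonup> 'b"
  assumes H1: "hilbert_space scale1 ip1"
    and H2: "hilbert_space scale2 ip2"
    and H3: "hilbert_space scale3 ip3"
    and R_linear: "linear_operator scale2 scale3 R" and R_dense: "densely_defined R"
    and S_linear: "linear_operator scale1 scale2 S" and S_dense: "densely_defined S"
  shows
    "((densely_defined (R \<circ>\<^sub>m S) \<and>
        op_adjoint ip1 ip3 (R \<circ>\<^sub>m S) = op_adjoint ip1 ip2 S \<circ>\<^sub>m op_adjoint ip2 ip3 R) \<longleftrightarrow>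
      orthogonal_complement (prod_ip ip1 ip3) (Map.graph (R \<circ>\<^sub>m S)) =
        flip ` Map.graph (op_adjoint ip1 ip2 S \<circ>\<^sub>m op_adjoint ip2 ip3 R)) \<and>
     (orthogonal_complement (prod_ip ip1 ip3) (Map.graph (R \<circ>\<^sub>m S)) =
        flip ` Map.graph (op_adjoint ip1 ip2 S \<circ>\<^sub>m op_adjoint ip2 ip3 R) \<longleftrightarrow>
      orthogonal_complement (prod_ip ip1 ip3) (Map.graph (R \<circ>\<^sub>m S)) \<subseteq>
        ran (block_operator (R \<circ>\<^sub>m S) (op_adjoint ip1 ip2 S \<circ>\<^sub>m op_adjoint ip2 ip3 R)))"
proof -
  let ?A = "R \<circ>\<^sub>m S" and ?B = "op_adjoint ip1 ip2 S \<circ>\<^sub>m op_adjoint ip2 ip3 R"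
  interpret H1: hilbert_space scale1 ip1 by fact
  interpret H2: hilbert_space scale2 ip2 by fact
  interpret H3: hilbert_space scale3 ip3 by fact
  note adjR = op_adjoint_eq_Some_iff[OF H2 R_dense, of ip3]
  note adjS = op_adjoint_eq_Some_iff[OF H1 S_dense, of ip2]
  have A0: "?A 0 = Some 0"
    using linear_operator_zero[OF H1 S_linear] linear_operator_zero[OF H2 R_linear]
    by (simp add: map_comp_Some_iff)
  have "op_adjoint ip2 ip3 R 0 = Some 0" "op_adjoint ip1 ip2 S 0 = Some 0"
    by (simp_all add: adjR adjS)
  then have B0: "?B 0 = Some 0" by (simp add: map_comp_Some_iff)
  have "(- h, k) \<in> orthogonal_complement (prod_ip ip1 ip3) (Map.graph ?A)" if B: "?B k = Some h" for h k
    unfolding mem_orthogonal_complement_graph_iff[OF H1]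
  proof
    fix x
    assume "x \<in> dom ?A"
    then obtain y z where xyz: "S x = Some y" "R y = Some z" "?A x = Some z"
      by (auto simp: map_comp_Some_iff)
    obtain l where "op_adjoint ip2 ip3 R k = Some l" "op_adjoint ip1 ip2 S l = Some h"
      using B by (auto simp: map_comp_Some_iff)
    \<comment> \<open>The adjoint relation of \<open>R\<close> moves \<open>k\<close> to
      \<open>l\<close>, and that of \<open>S\<close> moves \<open>l\<close> to
      \<open>h\<close>.\<close>
    then have "ip3 z k = ip2 y l" "ip2 y l = ip1 x h"
      using xyz unfolding adjR adjS by (metis domI option.sel)+
    then show "ip3 (the (?A x)) k = ip1 x h" by (simp add: xyz)
  qed
  then have "flip ` Map.graph ?B \<subseteq> orthogonal_complement (prod_ip ip1 ip3) (Map.graph ?A)"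
    by (auto simp: flip_def Map.graph_def)
  then show ?thesis
    using dense_and_adjoint_eq_iff[where A = ?A and B = ?B,
        OF H1 subspace_dom_map_comp[OF H1 H2 R_linear S_linear] B0 H3]
      orthogonal_complement_eq_iff_subset_ran[where A = ?A and B = ?B, OF H1 H3 A0]
    by blast
qed

end
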